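(* Let $\lambda\ge 0$ and let $\varphi(z)=1+B_1z+B_2z^2+B_3z^3+\cdots$ be analytic in $\mathbb{D}$ with $B_1>0$ and $B_2\in\mathbb{R}$. Let $f(z)=z+\sum_{n\ge2}a_nz^n$ belong to $\sigma$, with inverse $F=f^{-1}$ on $\mathbb{D}$, and suppose \[(1-\lambda)\frac{f(z)}{z}+\lambda f'(z)\prec\varphi(z)\quad\text{and}\quad (1-\lambda)\frac{F(w)}{w}+\lambda F'(w)\prec\varphi(w).\] (That is, $f\in\mathcal{R}_\sigma(\lambda,\varphi)$.) Then \[|a_2|\le\sqrt{\frac{B_1+|B_1-B_2|}{1+2\lambda}}.\]
   Context: $\mathbb{D}=\{z\in\mathbb{C}:|z|<1\}$. $\mathcal{A}$ denotes the class of analytic functions $f$ on $\mathbb{D}$ with $f(0)=0$, $f'(0)=1$, i.e. $f(z)=z+\sum_{n\ge2}a_nz^n$. The class $\sigma$ of bi-univalent functions consists of those $f\in\mathcal{A}$ that are univalent in $\mathbb{D}$ and whose inverse $f^{-1}$ (defined near $0$) extends to a univalent analytic function $F$ on $\mathbb{D}$; then $F(w)=w-a_2w^2+(2a_2^2-a_3)w^3+\cdots$. For analytic $g,h$ on $\mathbb{D}$, $g\prec h$ (subordination) means there is an analytic $\omega:\mathbb{D}\to\mathbb{D}$ with $\omega(0)=0$ and $g=h\circ\omega$ (equivalently $|\omega(z)|\le|z|$). *)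

theory Defs
  imports "HOL-Analysis.Analysis"
begin

definition subordinate :: "(complex \<Rightarrow> complex) \<Rightarrow> (complex \<Rightarrow> complex) \<Rightarrow> bool" where
  "subordinate g h \<longleftrightarrow>
     (\<exists>\<omega>. \<omega> holomorphic_on ball 0 1 \<and> \<omega> 0 = 0 \<and> \<omega> ` ball 0 1 \<subseteq> ball 0 1 \<and>
          (\<forall>z\<in>ball 0 1. g z = h (\<omega> z)))"

definition classA :: "(complex \<Rightarrow> complex) \<Rightarrow> bool" where
  "classA f \<longleftrightarrow> f holomorphic_on ball 0 1 \<and> f 0 = 0 \<and> deriv f 0 = 1"

text \<open>F is the univalent extension to the disk of the inverse of f (which is defined near 0).\<close>
definition bi_univalent_inverse :: "(complex \<Rightarrow> complex) \<Rightarrow> (complex \<Rightarrow> complex) \<Rightarrow> bool" where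
  "bi_univalent_inverse f F \<longleftrightarrow>
     classA f \<and> inj_on f (ball 0 1) \<and>
     F holomorphic_on ball 0 1 \<and> inj_on F (ball 0 1) \<and>
     (\<exists>r>0. \<forall>w\<in>ball 0 r. F w \<in> ball 0 1 \<and> f (F w) = w)"

text \<open>The function (1-lambda) f(z)/z + lambda f'(z), with its removable singularity at 0 filled in
  by its limit value 1 (valid since f(0)=0, f'(0)=1).\<close>
definition R_expr :: "real \<Rightarrow> (complex \<Rightarrow> complex) \<Rightarrow> complex \<Rightarrow> complex" where
  "R_expr lam f z = (if z = 0 then 1
                    else (1 - of_real lam) * (f z / z) + of_real lam * deriv f z)"

end

theory Submission
  imports Defs "HOL-Complex_Analysis.Complex_Analysis"
begin

text \<open>
  Write the two subordinations as \<open>\<phi> \<circ> u\<close> and \<open>\<phi> \<circ> v\<close> with Schwarz functions \<open>u\<close>, \<open>v\<close>.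
  Comparing coefficients, the linear ones give \<open>v\<^sub>1 = - u\<^sub>1\<close>, and adding the quadratic ones
  eliminates \<open>a\<^sub>3\<close>:
  \<open>2 (1 + 2 \<lambda>) a\<^sub>2\<^sup>2 = B\<^sub>1 (u\<^sub>2 + v\<^sub>2) + 2 B\<^sub>2 u\<^sub>1\<^sup>2\<close>.
  By Schwarz--Pick \<open>|u\<^sub>2|, |v\<^sub>2| \<le> 1 - |u\<^sub>1|\<^sup>2\<close>, so \<open>(1 + 2 \<lambda>) |a\<^sub>2|\<^sup>2\<close> is at most a convex
  combination of \<open>B\<^sub>1\<close> and \<open>|B\<^sub>2|\<close>, and both of these are at most \<open>B\<^sub>1 + |B\<^sub>1 - B\<^sub>2|\<close>.
\<close>

text \<open>Following \<open>g\<close> by the disk automorphism that sends \<open>g 0\<close> to 0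
  gives a self-map of the disk fixing 0, so the Schwarz lemma bounds its derivative there by 1. By
  the chain rule that derivative is \<open>deriv g 0\<close> divided by
  \<open>1 - (norm (g 0))\<^sup>2\<close>.\<close>

lemma Schwarz_Pick_deriv_0:
  assumes hol: "g holomorphic_on ball 0 1" and lt: "\<And>z. norm z < 1 \<Longrightarrow> norm (g z) < 1"
  shows "norm (deriv g 0) \<le> 1 - (norm (g 0))\<^sup>2"
proof -
  define a where "a = g 0"
  have a: "norm a < 1" using lt[of 0] by (simp add: a_def)
  define h where "h = (\<lambda>z. Moebius_function 0 a (g z))"
  have "(Moebius_function 0 a \<circ> g) holomorphic_on ball 0 1"
    using lt a by (intro holomorphic_on_compose_gen[OF hol Moebius_function_holomorphic]) auto
  then have holh: "h holomorphic_on ball 0 1" by (simp add: h_def o_def)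
  have h0: "h 0 = 0" by (simp add: h_def a_def Moebius_function_eq_zero)
  have hlt: "norm (h z) < 1" if "norm z < 1" for z
    using Moebius_function_norm_lt_1[OF a lt[OF that]] by (simp add: h_def)
  have le1: "norm (deriv h 0) \<le> 1"
    using Schwarz_Lemma(2)[OF holh h0 hlt, of 0] by simp
  have sq: "cnj a * a = of_real ((norm a)\<^sup>2)"
    by (metis complex_norm_square mult.commute)
  have pos: "1 - (norm a)\<^sup>2 > 0"
    using a by (simp add: power_less_one_iff abs_square_less_1)
  have nz: "1 - cnj a * g 0 \<noteq> 0"
  proof -
    have "1 - cnj a * g 0 = of_real (1 - (norm a)\<^sup>2)"
      using sq by (simp add: a_def)
    then show ?thesis using pos by (metis less_irrefl of_real_eq_0_iff)
  qed
  have dg: "(g has_field_derivative deriv g 0) (at 0)"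
    using holomorphic_derivI[OF hol, of 0] by simp
  \<comment> \<open>Quotient rule for \<open>(g z - a) / (1 - cnj a * g z)\<close>; the second term
    of the numerator vanishes because \<open>g 0 = a\<close>.\<close>
  have "(h has_field_derivative
      (deriv g 0 * (1 - cnj a * g 0) - (g 0 - a) * (- (cnj a * deriv g 0)))
        / ((1 - cnj a * g 0) * (1 - cnj a * g 0))) (at 0)"
    unfolding h_def Moebius_function_simple using nz
    by (auto intro!: derivative_eq_intros dg)
  then have "deriv h 0 = deriv g 0 / (1 - cnj a * g 0)"
    using nz by (simp add: DERIV_imp_deriv a_def)
  also have "1 - cnj a * g 0 = of_real (1 - (norm a)\<^sup>2)"
    using sq by (simp add: a_def)
  finally have "norm (deriv h 0) = norm (deriv g 0) / (1 - (norm a)\<^sup>2)"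
    using pos by (simp add: norm_divide del: of_real_diff)
  then show ?thesis using le1 pos by (simp add: a_def divide_le_eq)
qed

lemma has_fps_expansion_unique_ball:
  fixes f g :: "complex \<Rightarrow> complex"
  assumes "f has_fps_expansion A" "g has_fps_expansion B" "r > 0"
    and "\<And>z. norm z < r \<Longrightarrow> f z = g z"
  shows "A = B"
proof -
  have "eventually (\<lambda>z. f z = g z) (nhds 0)"
    using eventually_nhds_in_open[of "ball (0::complex) r" 0] assms(3,4)
    by (auto elim!: eventually_mono)
  from has_fps_expansion_cong[OF this refl] show ?thesis
    using assms(1,2) fps_expansion_unique_complex by metis
qed

text \<open>Dividing out the zero at the origin, \<open>w z = z * g z\<close>, turns the two
  coefficients into \<open>g 0\<close> and \<open>deriv g 0\<close>, so Schwarz-Pick for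
  \<open>g\<close> gives the bound. It applies unless \<open>g\<close> leaves the open disk, and
  then \<open>w\<close> is a rotation.\<close>

lemma Schwarz_second_coeff:
  assumes hol: "w holomorphic_on ball 0 1" and w0: "w 0 = 0"
    and lt: "\<And>z. norm z < 1 \<Longrightarrow> norm (w z) < 1" and exp: "w has_fps_expansion W"
  shows "norm (fps_nth W 2) \<le> 1 - (norm (fps_nth W 1))\<^sup>2"
proof -
  obtain g where g: "g holomorphic_on ball 0 1" "\<And>z. norm z < 1 \<Longrightarrow> w z = z * g z" "deriv w 0 = g 0"
    using Schwarz3[OF hol w0] by metis
  define G where "G = fps_expansion g 0"
  have G: "g has_fps_expansion G"
    unfolding G_def using g(1) by (intro has_fps_expansion_fps_expansion[of "ball 0 1"]) auto
  have "(\<lambda>z. z * g z) has_fps_expansion fps_X * G"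
    by (intro fps_expansion_intros G)
  then have W: "W = fps_X * G"
    using has_fps_expansion_unique_ball[OF exp _ zero_less_one g(2)] by blast
  have W1: "fps_nth W 1 = g 0" and W2: "fps_nth W 2 = deriv g 0"
    using fps_nth_fps_expansion[OF G, of 0] fps_nth_fps_expansion[OF G, of 1]
    by (simp_all add: W)
  show ?thesis
  proof (cases "\<forall>z. norm z < 1 \<longrightarrow> norm (g z) < 1")
    case True
    then show ?thesis using Schwarz_Pick_deriv_0[OF g(1)] unfolding W1 W2 by blast
  next
    case False
    then obtain z where z: "norm z < 1" "norm (g z) \<ge> 1" by force
    \<comment> \<open>A point with \<open>norm (g z) \<ge> 1\<close> forces equality in the Schwarz
      lemma: in the derivative bound if \<open>z = 0\<close>, in the growth bound otherwise. Hence
      \<open>w\<close> is a rotation, with second coefficient 0 and first coefficient of modulus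
      1.\<close>
    have "norm (deriv w 0) = 1 \<or> (\<exists>z. norm z < 1 \<and> z \<noteq> 0 \<and> norm (w z) = norm z)"
    proof (cases "z = 0")
      case True
      then show ?thesis using z g(3) Schwarz_Lemma(2)[OF hol w0 lt, of 0] by auto
    next
      case False
      have "norm (w z) \<le> norm z" using Schwarz_Lemma(1)[OF hol w0 lt z(1)] .
      moreover have "norm (w z) \<ge> norm z"
        using z g(2)[OF z(1)] by (simp add: norm_mult mult_le_cancel_left1)
      ultimately show ?thesis using False z by force
    qed
    then obtain c where c: "\<And>z. norm z < 1 \<Longrightarrow> w z = c * z" "norm c = 1"
      using Schwarz_Lemma(3)[OF hol w0 lt, of 0] by auto
    have "(\<lambda>z. c * z) has_fps_expansion fps_const c * fps_X"
      by (intro fps_expansion_intros)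
    then have "W = fps_const c * fps_X"
      using has_fps_expansion_unique_ball[OF exp _ zero_less_one c(1)] by blast
    then show ?thesis using c(2) by simp
  qed
qed

lemma fps_compose_nth_1_2:
  fixes A B :: "complex fps"
  assumes "fps_nth B 0 = 0"
  shows "fps_nth (fps_compose A B) 1 = fps_nth A 1 * fps_nth B 1"
    and "fps_nth (fps_compose A B) 2 = fps_nth A 1 * fps_nth B 2 + fps_nth A 2 * (fps_nth B 1)\<^sup>2"
  using assms
  by (simp_all add: fps_compose_nth numeral_2_eq_2 fps_mult_nth power2_eq_square)

text \<open>Here \<open>c\<close> and \<open>d\<close> are the first two Taylor coefficients of the
  Schwarz function of the subordination. The lemma serves both \<open>f\<close> and its inverse, so
  it does not ask for univalence.\<close>

lemma R_expr_subordinate_coeffs: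
  assumes hol: "f holomorphic_on ball 0 1" and f0: "f 0 = 0" and f: "f has_fps_expansion A"
    and p: "\<phi> has_fps_expansion P" and sub: "subordinate (R_expr lam f) \<phi>"
  obtains c d where "norm d \<le> 1 - (norm c)\<^sup>2"
    and "(1 + of_real lam) * fps_nth A 2 = fps_nth P 1 * c"
    and "(1 + 2 * of_real lam) * fps_nth A 3 = fps_nth P 1 * d + fps_nth P 2 * c\<^sup>2"
proof -
  obtain w where w: "w holomorphic_on ball 0 1" "w 0 = 0" "w ` ball 0 1 \<subseteq> ball 0 1"
    and eq: "\<And>z. z \<in> ball 0 1 \<Longrightarrow> R_expr lam f z = \<phi> (w z)"
    using sub unfolding subordinate_def by metis
  define W where "W = fps_expansion w 0"
  have W: "w has_fps_expansion W"
    unfolding W_def using w(1) by (intro has_fps_expansion_fps_expansion[of "ball 0 1"]) auto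
  have W0: "fps_nth W 0 = 0" using fps_nth_fps_expansion[OF W, of 0] w(2) by simp
  \<comment> \<open>Multiplying the subordination by \<open>z\<close> clears the quotient
    \<open>f z / z\<close>. This shifts indices by one: coefficients 1 and 2 of the composition meet
    coefficients 2 and 3 of \<open>A\<close>.\<close>
  have L: "(\<lambda>z. z * \<phi> (w z)) has_fps_expansion fps_X * fps_compose P W"
    using has_fps_expansion_compose[OF p W W0]
    by (intro fps_expansion_intros) (simp add: o_def)
  have R: "(\<lambda>z. (1 - of_real lam) * f z + of_real lam * (z * deriv f z)) has_fps_expansion
      fps_const (1 - of_real lam) * A + fps_const (of_real lam) * (fps_X * fps_deriv A)"
    by (intro fps_expansion_intros f)
  have "z * \<phi> (w z) = (1 - of_real lam) * f z + of_real lam * (z * deriv f z)"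
    if "norm z < 1" for z
    using eq[of z] that f0 by (cases "z = 0") (auto simp: R_expr_def field_simps simp flip: eq)
  then have E: "fps_X * fps_compose P W = fps_const (1 - of_real lam) * A + fps_const (of_real lam) * (fps_X * fps_deriv A)"
    using has_fps_expansion_unique_ball[OF L R zero_less_one] by blast
  show ?thesis
  proof (rule that)
    show "norm (fps_nth W 2) \<le> 1 - (norm (fps_nth W 1))\<^sup>2"
      using w(3) by (intro Schwarz_second_coeff[OF w(1,2) _ W]) (auto simp: image_subset_iff)
    show "(1 + of_real lam) * fps_nth A 2 = fps_nth P 1 * fps_nth W 1"
      using arg_cong[OF E, of "\<lambda>F. fps_nth F 2"] fps_compose_nth_1_2(1)[OF W0, of P]
      by (simp add: algebra_simps numeral_2_eq_2)
    show "(1 + 2 * of_real lam) * fps_nth A 3 = fps_nth P 1 * fps_nth W 2 + fps_nth P 2 * (fps_nth W 1)\<^sup>2"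
      using arg_cong[OF E, of "\<lambda>F. fps_nth F 3"] fps_compose_nth_1_2(2)[OF W0, of P]
      by (simp add: algebra_simps numeral_2_eq_2 numeral_3_eq_3)
  qed
qed

text \<open>The coefficients of \<open>X\<close>, \<open>X^2\<close> and \<open>X^3\<close> in the
  composition determine those of \<open>B\<close> one after another.\<close>

lemma inverse_fps_coeffs:
  fixes A B :: "complex fps"
  assumes "fps_compose A B = fps_X" "fps_nth B 0 = 0" "fps_nth A 1 = 1"
  shows "fps_nth B 2 = - fps_nth A 2" "fps_nth B 3 = 2 * (fps_nth A 2)\<^sup>2 - fps_nth A 3"
proof -
  have B1: "fps_nth B 1 = 1"
    using fps_compose_nth_1_2(1)[OF assms(2), of A] assms by simp
  show B2: "fps_nth B 2 = - fps_nth A 2"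
    using fps_compose_nth_1_2(2)[OF assms(2), of A] assms B1
    by (simp add: eq_neg_iff_add_eq_0)
  \<comment> \<open>In general this coefficient is \<open>a1 b3 + 2 a2 b1 b2 + a3 b1^3\<close>; here
    \<open>a1 = b1 = 1\<close>.\<close>
  have "fps_nth (fps_compose A B) 3 = fps_nth B 3 + 2 * fps_nth A 2 * fps_nth B 2 + fps_nth A 3"
    using assms(2,3) B1
    by (simp add: fps_compose_nth numeral_2_eq_2 numeral_3_eq_3 fps_mult_nth power2_eq_square algebra_simps)
  then show "fps_nth B 3 = 2 * (fps_nth A 2)\<^sup>2 - fps_nth A 3"
    using assms(1) B2 by (simp add: power2_eq_square algebra_simps eq_neg_iff_add_eq_0)
qed

theorem theorem1:
  fixes lam B1 B2 :: real and \<phi> f F :: "complex \<Rightarrow> complex"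
  assumes "lam \<ge> 0"
    and "\<phi> holomorphic_on ball 0 1" and "\<phi> 0 = 1"
    and "deriv \<phi> 0 = of_real B1" and "B1 > 0"
    and "(deriv ^^ 2) \<phi> 0 / 2 = of_real B2"
    and "bi_univalent_inverse f F"
    and "subordinate (R_expr lam f) \<phi>"
    and "subordinate (R_expr lam F) \<phi>"
  shows "norm ((deriv ^^ 2) f 0 / 2) \<le> sqrt ((B1 + \<bar>B1 - B2\<bar>) / (1 + 2 * lam))"
proof -
  have hf: "f holomorphic_on ball 0 1" "f 0 = 0" "deriv f 0 = 1" "inj_on f (ball 0 1)"
    and hF: "F holomorphic_on ball 0 1"
    using assms(7) by (auto simp: bi_univalent_inverse_def classA_def)
  obtain r where r: "r > 0" "\<And>w. w \<in> ball 0 r \<Longrightarrow> F w \<in> ball 0 1 \<and> f (F w) = w"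
    using assms(7) by (auto simp: bi_univalent_inverse_def)
  \<comment> \<open>Since \<open>f (F 0) = 0 = f 0\<close>, injectivity of \<open>f\<close> on the
    disk gives the value.\<close>
  have F0: "F 0 = 0"
    using r(2)[of 0] r(1) hf(2) inj_onD[OF hf(4), of "F 0" 0] by simp
  define A where "A = fps_expansion f 0"
  define B where "B = fps_expansion F 0"
  define P where "P = fps_expansion \<phi> 0"
  have A: "f has_fps_expansion A" and B: "F has_fps_expansion B" and P: "\<phi> has_fps_expansion P"
    unfolding A_def B_def P_def
    using hf(1) hF assms(2) by (auto intro!: has_fps_expansion_fps_expansion[of "ball 0 1"])
  have A1: "fps_nth A 1 = 1" and A2: "fps_nth A 2 = (deriv ^^ 2) f 0 / 2"
    using fps_nth_fps_expansion[OF A, of 1] fps_nth_fps_expansion[OF A, of 2] hf(3) by simp_all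
  have P1: "fps_nth P 1 = of_real B1" and P2: "fps_nth P 2 = of_real B2"
    using fps_nth_fps_expansion[OF P, of 1] fps_nth_fps_expansion[OF P, of 2] assms(4,6) by simp_all
  have B0: "fps_nth B 0 = 0" using fps_nth_fps_expansion[OF B, of 0] F0 by simp
  have "(\<lambda>z. f (F z)) has_fps_expansion fps_compose A B"
    using has_fps_expansion_compose[OF A B B0] by (simp add: o_def)
  from has_fps_expansion_unique_ball[OF this has_fps_expansion_fps_X r(1)]
  have AB: "fps_compose A B = fps_X"
    using r(2) by simp
  note inv = inverse_fps_coeffs[OF AB B0 A1]
  define a where "a = fps_nth A 2"
  obtain c d :: complex where cd: "norm d \<le> 1 - (norm c)\<^sup>2" "(1 + of_real lam) * a = B1 * c"
      "(1 + 2 * of_real lam) * fps_nth A 3 = B1 * d + B2 * c\<^sup>2"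
    using R_expr_subordinate_coeffs[OF hf(1,2) A P assms(8)] P1 P2 unfolding a_def by metis
  obtain c' d' :: complex where cd': "norm d' \<le> 1 - (norm c')\<^sup>2" "(1 + of_real lam) * (- a) = B1 * c'"
      "(1 + 2 * of_real lam) * (2 * a\<^sup>2 - fps_nth A 3) = B1 * d' + B2 * c'\<^sup>2"
    using R_expr_subordinate_coeffs[OF hF F0 B P assms(9)] P1 P2 inv unfolding a_def by metis
  \<comment> \<open>The second coefficients of \<open>f\<close> and \<open>F\<close> are opposite,
    hence so are the linear Schwarz coefficients; their squares then agree, and one \<open>t\<close>
    serves both bounds.\<close>
  have "complex_of_real B1 * c' = complex_of_real B1 * (- c)"
    using cd(2) cd'(2) by simp
  then have c': "c' = - c" using \<open>B1 > 0\<close> by (simp only: mult_cancel_left) simp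
  define t where "t = (norm c)\<^sup>2"
  have t: "t \<ge> 0" "t \<le> 1" using cd(1) norm_ge_zero[of d] by (auto simp: t_def simp del: norm_ge_zero)
  \<comment> \<open>Sum of the two quadratic relations, in which \<open>fps_nth A 3\<close>
    cancels.\<close>
  have "complex_of_real (2 * (1 + 2 * lam)) * a\<^sup>2 = B1 * (d + d') + 2 * (B2 * c\<^sup>2)"
    using cd(3) cd'(3) c' by (simp add: algebra_simps)
  then have "norm (complex_of_real (2 * (1 + 2 * lam)) * a\<^sup>2) = norm (B1 * (d + d') + 2 * (B2 * c\<^sup>2))"
    by simp
  moreover have "norm (complex_of_real (2 * (1 + 2 * lam)) * a\<^sup>2) = 2 * (1 + 2 * lam) * (norm a)\<^sup>2"
    using \<open>lam \<ge> 0\<close> unfolding norm_mult norm_of_real norm_power by simp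
  moreover have "norm (B1 * (d + d') + 2 * (B2 * c\<^sup>2)) \<le> B1 * norm (d + d') + 2 * (\<bar>B2\<bar> * t)"
    using norm_triangle_ineq[of "B1 * (d + d')" "2 * (B2 * c\<^sup>2)"] \<open>B1 > 0\<close>
    by (simp add: norm_mult norm_power t_def)
  moreover have "norm (d + d') \<le> 2 * (1 - t)"
    using norm_triangle_ineq[of d d'] cd(1) cd'(1) c' by (simp add: t_def)
  then have "B1 * norm (d + d') \<le> B1 * (2 * (1 - t))"
    using \<open>B1 > 0\<close> by simp
  ultimately have "(1 + 2 * lam) * (norm a)\<^sup>2 \<le> B1 * (1 - t) + \<bar>B2\<bar> * t"
    by (simp add: algebra_simps)
  \<comment> \<open>The bound on \<open>\<bar>B2\<bar>\<close> is the triangle inequality for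
    \<open>B2 = B1 - (B1 - B2)\<close>.\<close>
  also have "\<dots> \<le> (B1 + \<bar>B1 - B2\<bar>) * (1 - t) + (B1 + \<bar>B1 - B2\<bar>) * t"
    using t \<open>B1 > 0\<close> by (intro add_mono mult_right_mono) auto
  also have "\<dots> = B1 + \<bar>B1 - B2\<bar>" by (simp add: algebra_simps)
  finally have "(norm a)\<^sup>2 \<le> (B1 + \<bar>B1 - B2\<bar>) / (1 + 2 * lam)"
    using \<open>lam \<ge> 0\<close> by (simp add: le_divide_eq mult.commute)
  then show ?thesis
    unfolding a_def A2 by (rule real_le_rsqrt)
qed

end
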